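(* For any $\sigma$-program $P$ with $\mathrm{Lab}_P^{\mathrm{fin}}\neq\emptyset$, the set $\mathrm{Lab}_P^{\mathrm{fin}}$ is $(1,A_1)$-enumerable by a BSS RAM in $\mathsf M_{A_{L_P}}$.
   Context: **Programs.** Let $\sigma=(n_1;m_1,\ldots,m_{n_2};k_1,\ldots,k_{n_3})$ be a finite signature with constant symbols $c_i^0$, operation symbols $f_i^{m_i}$, relation symbols $r_i^{k_i}$. A $\sigma$-program $P$ is a list $1:\mathrm{instruction}_1;\ \ldots;\ \ell_P-1:\mathrm{instruction}_{\ell_P-1};\ \ell_P:\text{stop}$ with $\ell_P\ge1$, where each instruction with label $\ell<\ell_P$ has one of the forms: (1) $Z_j:=f_i^{m_i}(Z_{j_1},\ldots,Z_{j_{m_i}})$; (2) $Z_j:=c_i^0$; (3) $Z_{I_j}:=Z_{I_k}$; (4) if $r_i^{k_i}(Z_{j_1},\ldots,Z_{j_{k_i}})$ then goto $\ell_1'$ else goto $\ell_2'$; (5) if $I_j=I_k$ then goto $\ell_1'$ else goto $\ell_2'$; (6) $I_j:=1$; (7) $I_j:=I_j+1$; (11) goto $\ell_1'$ or goto $\ell_2'$; with $\ell_1',\ell_2'\in L_P=\{1,\ldots,\ell_P\}$. Let $L_P^{\circ}=\{1,\ldots,\ell_P-1\}$, $L_P^{\mathrm B}$ = labels of types (4),(5),(11), $L_P^{\mathrm{NB}}=L_P^\circ\setminus L_P^{\mathrm B}$. Put $\beta_P(\ell)=\ell+1$ for $\ell\in L_P^{\mathrm{NB}}$ and, for $\ell\in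 L_P^{\mathrm B}$, $\beta_P^+(\ell)=\ell_1'$, $\beta_P^-(\ell)=\ell_2'$. **Finite $P$-paths.** A finite $P$-path of length $s\ge1$ is $(\ell_1,\ldots,\ell_s)\in L_P^s$ with $\ell_1=1$, $\ell_s=\ell_P$, $\ell_t\in L_P^\circ$ for $t<s$, and for all $t<s$: $\ell_{t+1}=\beta_P(\ell_t)$ if $\ell_t\in L_P^{\mathrm{NB}}$, $\ell_{t+1}\in\{\beta_P^+(\ell_t),\beta_P^-(\ell_t)\}$ if $\ell_t\in L_P^{\mathrm B}$. $\mathrm{Lab}_P^{\mathrm{fin}}$ is the set of all finite $P$-paths. **The structure $A_{L_P}$.** $A_{L_P}=(L_P\cup\{0\};\,L_P\cup\{0\};\,\hat\beta_P,\hat\beta_P^+,\hat\beta_P^-;\,=)$: universe $\{0,1,\ldots,\ell_P\}$, every element is a constant, the three unary functions are the total extensions of $\beta_P$ (from $L_P^{\mathrm{NB}}$) and $\beta_P^+,\beta_P^-$ (from $L_P^{\mathrm B}$) by the value $0$ elsewhere, and the only relation is the identity. **Deterministic BSS RAMs.** For a structure $A$ with universe $U_A$ and $U_A^\infty=\bigcup_{n\ge1}U_A^n$, a machine $M\in\mathsf M_A$ is given by a program, that is, a list $1:\mathrm{instruction}_1;\ \ldots;\ q-1:\mathrm{instruction}_{q-1};\ q:\text{stop}$ with $q\ge1$ in which each instruction with label less than $q$ has one of the forms (1) $Z_j:=f_i^{m_i}(Z_{j_1},\ldots,Z_{j_{m_i}})$, (2) $Z_j:=c_i^0$, (3) $Z_{I_j}:=Z_{I_k}$,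 (4) if $r_i^{k_i}(Z_{j_1},\ldots,Z_{j_{k_i}})$ then goto $q_1$ else goto $q_2$, (5) if $I_j=I_k$ then goto $q_1$ else goto $q_2$, (6) $I_j:=1$, (7) $I_j:=I_j+1$, with $q_1,q_2\in\{1,\ldots,q\}$ and with $f_i^{m_i}$, $c_i^0$, $r_i^{k_i}$ operation, constant and relation symbols of the signature of $A$ (interpreted in $A$), and by finitely many index registers $I_1,\ldots,I_{k_M}$ (with values in $\mathbb N_+$) including all those occurring in its program; it has registers $Z_1,Z_2,\ldots$ with values in $U_A$. On input $\vec x\in U_A^n$ it starts at label $1$ with index values $(n,1,\ldots,1)$ and $Z$-values $(x_1,\ldots,x_n,x_n,x_n,\ldots)$. Instructions are executed in the obvious way (type (3) copies the content of $Z_{c(I_k)}$ into $Z_{c(I_j)}$, where $c(\cdot)$ denotes register content; non-branching instructions lead to the next label). When the stop instruction is reached the output is $\mathrm{Res}_M(\vec x)=(c(Z_1),\ldots,c(Z_{c(I_1)}))$. An $A$-machine with input space $\{u\}^\infty=\bigcup_{n\ge1}\{u\}^n$ is defined in the same way but takes only inputs $\vec u^{[n]}=(u,\ldots,u)\in\{u\}^n$, $n\ge1$. **Enumerability.** For $u\in U_A$, a set $N\subseteq U_A^\infty$ is $(u,A_u)$-enumerable by a BSS RAM if there is a machine in $\mathsf M_A$ that first computes $\vec u^{[n]}$ for any input $\vec x\in U_A^n$, $n\ge1$, and then simulates an $A$-machine (with input space $\{u\}^\infty$) computing a surjective function $f:\{u\}^\infty\to N$; thus its result on every $\vec x\in U_A^n$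 is $f(\vec u^{[n]})$. Here $A=A_{L_P}$ and $u=1$. *)

theory Defs
  imports Main
begin

section \<open>Signatures and programs\<close>

text \<open>Registers and labels are numbered from 1 as usual. Constant, operation and relation symbols
  are numbered from 0, so that a symbol is a position in the corresponding list.\<close>

record signature =
  sig_consts :: nat
  sig_ops :: "nat list"
  sig_rels :: "nat list"

datatype det_instr =
    Apply nat nat "nat list"        \<comment> \<open>\<open>Apply j i js\<close>: \<open>Z_j := f_i(Z_js)\<close>\<close>
  | LoadConst nat nat               \<comment> \<open>\<open>LoadConst j i\<close>: \<open>Z_j := c_i\<close>\<close>
  | Copy nat nat                    \<comment> \<open>\<open>Copy j k\<close>: \<open>Z_{I_j} := Z_{I_k}\<close>\<close>
  | IfRel nat "nat list" nat nat    \<comment> \<open>\<open>IfRel i js l1 l2\<close>: if \<open>r_i(Z_js)\<close> then goto \<open>l1\<close> else goto \<open>l2\<close>\<close>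
  | IfIndexEq nat nat nat nat       \<comment> \<open>\<open>IfIndexEq j k l1 l2\<close>: if \<open>I_j = I_k\<close> then goto \<open>l1\<close> else goto \<open>l2\<close>\<close>
  | IndexOne nat                    \<comment> \<open>\<open>I_j := 1\<close>\<close>
  | IndexIncr nat                   \<comment> \<open>\<open>I_j := I_j + 1\<close>\<close>

datatype instr =
    Det det_instr
  | GotoOr nat nat                  \<comment> \<open>goto \<open>l1\<close> or goto \<open>l2\<close>\<close>

text \<open>A program is the list of its instructions without the final stop instruction: the instruction
  with label \<open>l\<close> is \<open>P ! (l - 1)\<close>, and the stop instruction has the label \<open>Suc (length P)\<close>.\<close>

definition stop_label :: "'i list \<Rightarrow> nat" where
  "stop_label P = Suc (length P)"

definition labels :: "'i list \<Rightarrow> nat set" where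
  "labels P = {1..stop_label P}"

definition inner_labels :: "'i list \<Rightarrow> nat set" where
  "inner_labels P = {1..<stop_label P}"

definition instr_at :: "'i list \<Rightarrow> nat \<Rightarrow> 'i" where
  "instr_at P l = P ! (l - 1)"

fun wf_det_instr :: "signature \<Rightarrow> nat set \<Rightarrow> det_instr \<Rightarrow> bool" where
  "wf_det_instr \<sigma> L (Apply j i js) \<longleftrightarrow> 1 \<le> j \<and> (\<forall>j'\<in>set js. 1 \<le> j') \<and>
     i < length (sig_ops \<sigma>) \<and> length js = sig_ops \<sigma> ! i"
| "wf_det_instr \<sigma> L (LoadConst j i) \<longleftrightarrow> 1 \<le> j \<and> i < sig_consts \<sigma>"
| "wf_det_instr \<sigma> L (Copy j k) \<longleftrightarrow> 1 \<le> j \<and> 1 \<le> k"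
| "wf_det_instr \<sigma> L (IfRel i js l1 l2) \<longleftrightarrow> (\<forall>j'\<in>set js. 1 \<le> j') \<and>
     i < length (sig_rels \<sigma>) \<and> length js = sig_rels \<sigma> ! i \<and> l1 \<in> L \<and> l2 \<in> L"
| "wf_det_instr \<sigma> L (IfIndexEq j k l1 l2) \<longleftrightarrow> 1 \<le> j \<and> 1 \<le> k \<and> l1 \<in> L \<and> l2 \<in> L"
| "wf_det_instr \<sigma> L (IndexOne j) \<longleftrightarrow> 1 \<le> j"
| "wf_det_instr \<sigma> L (IndexIncr j) \<longleftrightarrow> 1 \<le> j"

fun wf_instr :: "signature \<Rightarrow> nat set \<Rightarrow> instr \<Rightarrow> bool" where
  "wf_instr \<sigma> L (Det d) \<longleftrightarrow> wf_det_instr \<sigma> L d"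
| "wf_instr \<sigma> L (GotoOr l1 l2) \<longleftrightarrow> l1 \<in> L \<and> l2 \<in> L"

definition is_program :: "signature \<Rightarrow> instr list \<Rightarrow> bool" where
  "is_program \<sigma> P \<longleftrightarrow> (\<forall>ins\<in>set P. wf_instr \<sigma> (labels P) ins)"

section \<open>Finite paths of a program\<close>

fun targets :: "instr \<Rightarrow> (nat \<times> nat) option" where
  "targets (Det (IfRel i js l1 l2)) = Some (l1, l2)"
| "targets (Det (IfIndexEq j k l1 l2)) = Some (l1, l2)"
| "targets (GotoOr l1 l2) = Some (l1, l2)"
| "targets _ = None"

definition branch_labels :: "instr list \<Rightarrow> nat set" where
  "branch_labels P = {l \<in> inner_labels P. targets (instr_at P l) \<noteq> None}"

definition nonbranch_labels :: "instr list \<Rightarrow> nat set" where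
  "nonbranch_labels P = inner_labels P - branch_labels P"

definition beta :: "instr list \<Rightarrow> nat \<rightharpoonup> nat" where
  "beta P l = (if l \<in> nonbranch_labels P then Some (l + 1) else None)"

definition beta_plus :: "instr list \<Rightarrow> nat \<rightharpoonup> nat" where
  "beta_plus P l =
     (if l \<in> branch_labels P then map_option fst (targets (instr_at P l)) else None)"

definition beta_minus :: "instr list \<Rightarrow> nat \<rightharpoonup> nat" where
  "beta_minus P l =
     (if l \<in> branch_labels P then map_option snd (targets (instr_at P l)) else None)"

definition finite_path :: "instr list \<Rightarrow> nat list \<Rightarrow> bool" where
  "finite_path P ls \<longleftrightarrow>
     ls \<noteq> [] \<and> set ls \<subseteq> labels P \<and> hd ls = 1 \<and> last ls = stop_label P \<and>
     (\<forall>t. Suc t < length ls \<longrightarrow>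
        ls ! t \<in> inner_labels P \<and>
        (ls ! t \<in> nonbranch_labels P \<longrightarrow> Some (ls ! Suc t) = beta P (ls ! t)) \<and>
        (ls ! t \<in> branch_labels P \<longrightarrow>
           Some (ls ! Suc t) \<in> {beta_plus P (ls ! t), beta_minus P (ls ! t)}))"

definition Lab_fin :: "instr list \<Rightarrow> nat list set" where
  "Lab_fin P = {ls. finite_path P ls}"

section \<open>Structures\<close>

text \<open>Each operation and each relation is paired with its arity; it is only ever applied to lists
  of that length over the universe.\<close>

record 'a algebraic_structure =
  univ :: "'a set"
  const_list :: "'a list"
  op_list :: "(nat \<times> ('a list \<Rightarrow> 'a)) list"
  rel_list :: "(nat \<times> ('a list \<Rightarrow> bool)) list"

definition signature_of :: "'a algebraic_structure \<Rightarrow> signature" where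
  "signature_of A = \<lparr>sig_consts = length (const_list A),
     sig_ops = map fst (op_list A), sig_rels = map fst (rel_list A)\<rparr>"

definition tuples :: "'a set \<Rightarrow> 'a list set" where
  "tuples U = {xs. xs \<noteq> [] \<and> set xs \<subseteq> U}"

definition total_ext :: "(nat \<rightharpoonup> nat) \<Rightarrow> nat \<Rightarrow> nat" where
  "total_ext g l = (case g l of None \<Rightarrow> 0 | Some l' \<Rightarrow> l')"

definition label_structure :: "instr list \<Rightarrow> nat algebraic_structure" where
  "label_structure P = \<lparr>
     univ = labels P \<union> {0},
     const_list = [0..<Suc (stop_label P)],
     op_list = [(1, \<lambda>xs. total_ext (beta P) (xs ! 0)),
                (1, \<lambda>xs. total_ext (beta_plus P) (xs ! 0)),
                (1, \<lambda>xs. total_ext (beta_minus P) (xs ! 0))],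
     rel_list = [(2, \<lambda>xs. xs ! 0 = xs ! 1)]\<rparr>"

section \<open>Deterministic BSS RAMs\<close>

record machine =
  code :: "det_instr list"
  num_index :: nat

fun index_regs :: "det_instr \<Rightarrow> nat set" where
  "index_regs (Copy j k) = {j, k}"
| "index_regs (IfIndexEq j k l1 l2) = {j, k}"
| "index_regs (IndexOne j) = {j}"
| "index_regs (IndexIncr j) = {j}"
| "index_regs _ = {}"

text \<open>\<open>num_index M \<ge> 1\<close> because \<open>I_1\<close> carries the input and output lengths.\<close>

definition machines :: "'a algebraic_structure \<Rightarrow> machine set" where
  "machines A = {M. 1 \<le> num_index M \<and>
     (\<forall>ins\<in>set (code M). wf_det_instr (signature_of A) (labels (code M)) ins \<and>
        index_regs ins \<subseteq> {1..num_index M})}"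

text \<open>Only the index registers \<open>1, \<dots>, num_index M\<close> and the registers \<open>Z_1, Z_2, \<dots>\<close> are meaningful;
  the values of \<open>ireg\<close> and \<open>zreg\<close> elsewhere are neither read nor changed.\<close>

record 'a config =
  lab :: nat
  ireg :: "nat \<Rightarrow> nat"
  zreg :: "nat \<Rightarrow> 'a"

definition init_config :: "'a list \<Rightarrow> 'a config" where
  "init_config xs = \<lparr>lab = 1,
     ireg = (\<lambda>j. if j = 1 then length xs else 1),
     zreg = (\<lambda>j. if j \<le> length xs then xs ! (j - 1) else last xs)\<rparr>"

fun exec :: "'a algebraic_structure \<Rightarrow> det_instr \<Rightarrow> 'a config \<Rightarrow> 'a config" where
  "exec A (Apply j i js) c = c\<lparr>lab := lab c + 1,
     zreg := (zreg c)(j := snd (op_list A ! i) (map (zreg c) js))\<rparr>"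
| "exec A (LoadConst j i) c = c\<lparr>lab := lab c + 1, zreg := (zreg c)(j := const_list A ! i)\<rparr>"
| "exec A (Copy j k) c = c\<lparr>lab := lab c + 1,
     zreg := (zreg c)(ireg c j := zreg c (ireg c k))\<rparr>"
| "exec A (IfRel i js l1 l2) c =
     c\<lparr>lab := if snd (rel_list A ! i) (map (zreg c) js) then l1 else l2\<rparr>"
| "exec A (IfIndexEq j k l1 l2) c = c\<lparr>lab := if ireg c j = ireg c k then l1 else l2\<rparr>"
| "exec A (IndexOne j) c = c\<lparr>lab := lab c + 1, ireg := (ireg c)(j := 1)\<rparr>"
| "exec A (IndexIncr j) c = c\<lparr>lab := lab c + 1, ireg := (ireg c)(j := ireg c j + 1)\<rparr>"

definition step :: "'a algebraic_structure \<Rightarrow> machine \<Rightarrow> 'a config \<Rightarrow> 'a config" where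
  "step A M c =
     (if lab c \<in> inner_labels (code M) then exec A (instr_at (code M) (lab c)) c else c)"

definition run :: "'a algebraic_structure \<Rightarrow> machine \<Rightarrow> 'a list \<Rightarrow> nat \<Rightarrow> 'a config" where
  "run A M xs t = (step A M ^^ t) (init_config xs)"

definition out_tuple :: "'a config \<Rightarrow> 'a list" where
  "out_tuple c = map (zreg c) [1..<Suc (ireg c 1)]"

text \<open>The tuple \<open>(c(Z_1), \<dots>, c(Z_{c(I_1)}))\<close> at the first time the label \<open>p\<close> is reached.\<close>

definition result_at ::
  "'a algebraic_structure \<Rightarrow> machine \<Rightarrow> nat \<Rightarrow> 'a list \<Rightarrow> 'a list option" where
  "result_at A M p xs =
     (if \<exists>t. lab (run A M xs t) = p
      then Some (out_tuple (run A M xs (LEAST t. lab (run A M xs t) = p)))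
      else None)"

definition Res :: "'a algebraic_structure \<Rightarrow> machine \<Rightarrow> 'a list \<Rightarrow> 'a list option" where
  "Res A M = result_at A M (stop_label (code M))"

section \<open>Enumerability\<close>

text \<open>\<open>M'\<close> is the machine with input space \<open>{u}^\<infinity>\<close>, so that its behaviour on other inputs is irrelevant,
  and it computes \<open>f\<close>. The label \<open>p\<close> marks the end of the first phase of \<open>M\<close>, in which
  \<open>(u, \<dots>, u)\<close> is computed. That \<open>M\<close> then simulates \<open>M'\<close> on this tuple is understood with respect to
  results: \<open>M\<close> halts with the result of \<open>M'\<close>.  A literal step-by-step agreement of the registers is
  impossible, since almost all Z-registers of \<open>M\<close> still contain the last input component.\<close>

definition BSS_enumerable ::
  "'a algebraic_structure \<Rightarrow> 'a \<Rightarrow> 'a list set \<Rightarrow> bool" where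
  "BSS_enumerable A u N \<longleftrightarrow>
     u \<in> univ A \<and> N \<subseteq> tuples (univ A) \<and>
     (\<exists>M\<in>machines A. \<exists>M'\<in>machines A. \<exists>f. \<exists>p\<in>labels (code M).
        f ` tuples {u} = N \<and>
        (\<forall>us\<in>tuples {u}. Res A M' us = Some (f us)) \<and>
        (\<forall>xs\<in>tuples (univ A).
           result_at A M p xs = Some (replicate (length xs) u) \<and>
           Res A M xs = Res A M' (replicate (length xs) u)))"

end

theory Submission
  imports Defs
begin

text \<open>A finite path is determined by the choice, at each of its entries, of one of the three operations
  of the structure that leads to the next entry. As the operations are extended by \<open>0\<close>, which is
  absorbing, a sequence of such choices starting from the label \<open>1\<close> yields a finite path as soon as
  the last entry is the stop label. Reading an input length as a sequence of ternary digits therefore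
  reaches every finite path; a length that yields no path is replaced by a fixed one, hard-coded in
  the machine, that does. Since everything after the first phase depends only on the input length,
  one machine serves both as the enumerating machine and as the one computing \<open>f\<close>.\<close>

section \<open>Reachability\<close>

text \<open>Before the configuration satisfying \<open>Q\<close> the label \<open>p\<close> does not occur. Proofs run backwards along
  the program, in the manner of weakest preconditions.\<close>

inductive reaches ::
  "'a algebraic_structure \<Rightarrow> machine \<Rightarrow> nat \<Rightarrow> ('a config \<Rightarrow> bool) \<Rightarrow> 'a config \<Rightarrow> bool"
  for A M p Q where
  now: "Q c \<Longrightarrow> reaches A M p Q c"
| later: "lab c \<noteq> p \<Longrightarrow> reaches A M p Q (step A M c) \<Longrightarrow> reaches A M p Q c"

text \<open>The depth of a derivation is the running time, and every use of \<open>later\<close>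
  records that \<open>p\<close> has not been met yet.\<close>

lemma reaches_first_time:
  assumes "reaches A M p Q c"
  shows "\<exists>t. (\<forall>s<t. lab ((step A M ^^ s) c) \<noteq> p) \<and> Q ((step A M ^^ t) c)"
  using assms
proof (induction rule: reaches.induct)
  case (now c)
  then show ?case by (intro exI[of _ 0]) simp
next
  case (later c)
  then obtain t where t: "\<forall>s<t. lab ((step A M ^^ s) (step A M c)) \<noteq> p"
    "Q ((step A M ^^ t) (step A M c))" by blast
  have "lab ((step A M ^^ s) c) \<noteq> p" if "s < Suc t" for s
    using that t(1) later.hyps(1) by (cases s) (simp_all add: funpow_swap1)
  with t(2) show ?case
    by (intro exI[of _ "Suc t"]) (simp add: funpow_swap1)
qed

lemma reaches_result_at:
  assumes "reaches A M p (\<lambda>c. lab c = p \<and> out_tuple c = ys) (init_config xs)"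
  shows "result_at A M p xs = Some ys"
proof -
  obtain t where t: "\<forall>s<t. lab (run A M xs s) \<noteq> p"
    "lab (run A M xs t) = p" "out_tuple (run A M xs t) = ys"
    using reaches_first_time[OF assms] unfolding run_def by blast
  have "(LEAST t. lab (run A M xs t) = p) = t"
    using t(1,2) by (intro Least_equality) (auto simp: not_less[symmetric])
  with t(2,3) show ?thesis unfolding result_at_def by auto
qed

lemma out_tuple_eq: "out_tuple c = map (\<lambda>t. zreg c (Suc t)) [0..<ireg c 1]"
  unfolding out_tuple_def One_nat_def by (simp only: map_Suc_upt[symmetric] map_map comp_def)

section \<open>Paths as digit sequences\<close>

text \<open>Read off \<open>op_list\<close>, so that executing \<open>Apply 1 d [1]\<close> folds
  into it by \<open>next_label_def[symmetric]\<close>.\<close>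

definition next_label :: "instr list \<Rightarrow> nat \<Rightarrow> nat \<Rightarrow> nat" where
  "next_label P d l = snd (op_list (label_structure P) ! d) [l]"

lemma next_label_simps:
  "next_label P 0 = total_ext (beta P)"
  "next_label P (Suc 0) = total_ext (beta_plus P)"
  "next_label P 2 = total_ext (beta_minus P)"
  by (simp_all add: next_label_def label_structure_def fun_eq_iff)

text \<open>The domains of the three partial maps already encode the split into branching and
  non-branching labels.\<close>

definition label_succ :: "instr list \<Rightarrow> nat \<Rightarrow> nat \<Rightarrow> bool" where
  "label_succ P l l' \<longleftrightarrow> Some l' \<in> {beta P l, beta_plus P l, beta_minus P l}"

lemma label_succ_imp_next_label:
  assumes "label_succ P l l'"
  shows "\<exists>d<3. l' = next_label P d l"
proof -
  have "l' \<in> {next_label P 0 l, next_label P (Suc 0) l, next_label P 2 l}"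
    using assms unfolding label_succ_def next_label_simps total_ext_def
    by (auto split: option.splits)
  moreover have "0 < (3::nat)" "Suc 0 < 3" "2 < (3::nat)" by auto
  ultimately show ?thesis by blast
qed

lemma next_label_imp_label_succ:
  assumes "d < 3" "next_label P d l \<noteq> 0"
  shows "label_succ P l (next_label P d l)"
proof -
  have "d = 0 \<or> d = Suc 0 \<or> d = 2" using assms(1) by auto
  with assms(2) show ?thesis
    by (elim disjE) (auto simp: label_succ_def next_label_simps total_ext_def split: option.splits)
qed

lemma label_succ_inner:
  "label_succ P l l' \<Longrightarrow> l \<in> inner_labels P"
  by (auto simp: label_succ_def beta_def beta_plus_def beta_minus_def branch_labels_def
      nonbranch_labels_def split: if_splits)

lemma targets_in_labels:
  assumes "wf_instr \<sigma> L i" "targets i = Some (l1, l2)"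
  shows "l1 \<in> L \<and> l2 \<in> L"
  using assms by (cases "(\<sigma>, L, i)" rule: wf_instr.cases; simp)
    (erule targets.elims; auto)

lemma label_succ_in_labels:
  assumes "is_program \<sigma> P" "label_succ P l l'"
  shows "l' \<in> labels P"
proof -
  have l: "l \<in> inner_labels P" using label_succ_inner[OF assms(2)] .
  then have "instr_at P l \<in> set P"
    by (auto simp: instr_at_def inner_labels_def stop_label_def)
  then have wf: "wf_instr \<sigma> (labels P) (instr_at P l)" using assms(1) by (auto simp: is_program_def)
  show ?thesis
  proof (cases "targets (instr_at P l)")
    case None
    then show ?thesis using assms(2) l
      by (auto simp: label_succ_def beta_def beta_plus_def beta_minus_def labels_def
          inner_labels_def split: if_splits)
  next
    case (Some ll)
    then show ?thesis using assms(2) l targets_in_labels[OF wf, of "fst ll" "snd ll"]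
      by (auto simp: label_succ_def beta_def beta_plus_def beta_minus_def nonbranch_labels_def
          branch_labels_def split: if_splits)
  qed
qed

text \<open>Each step of a well-formed program stays inside \<open>labels P\<close>, so containment
  in the labels follows from the start label and the steps.\<close>

lemma finite_path_iff:
  assumes "is_program \<sigma> P"
  shows "finite_path P ls \<longleftrightarrow> ls \<noteq> [] \<and> hd ls = 1 \<and> last ls = stop_label P \<and>
    (\<forall>t. Suc t < length ls \<longrightarrow> label_succ P (ls ! t) (ls ! Suc t))"
proof -
  have step_iff: "(l \<in> inner_labels P \<and> (l \<in> nonbranch_labels P \<longrightarrow> Some l' = beta P l) \<and>
      (l \<in> branch_labels P \<longrightarrow> Some l' \<in> {beta_plus P l, beta_minus P l})) \<longleftrightarrow> label_succ P l l'"
    for l l'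
    using label_succ_inner[of P l l']
    by (auto simp: label_succ_def nonbranch_labels_def beta_def beta_plus_def beta_minus_def)
  have "set ls \<subseteq> labels P" if "ls \<noteq> []" "hd ls = 1"
      and succ: "\<forall>t. Suc t < length ls \<longrightarrow> label_succ P (ls ! t) (ls ! Suc t)"
  proof
    fix l assume "l \<in> set ls"
    then obtain t where t: "t < length ls" "l = ls ! t" by (metis in_set_conv_nth)
    show "l \<in> labels P"
    proof (cases t)
      case 0
      then show ?thesis using that t by (simp add: hd_conv_nth labels_def stop_label_def)
    next
      case (Suc t')
      then show ?thesis using succ t label_succ_in_labels[OF assms] by blast
    qed
  qed
  then show ?thesis unfolding finite_path_def step_iff by blast
qed

text \<open>The number \<open>n \<ge> 2\<close> is read as the pair \<open>(d, q)\<close> with \<open>n + 1 = 3 q + d\<close> and \<open>d < 3\<close>, where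
  \<open>d\<close> selects one of the three operations of the structure.\<close>

function trace :: "instr list \<Rightarrow> nat list \<Rightarrow> nat \<Rightarrow> nat list" where
  "trace P w n =
     (if n \<le> 1 then w
      else trace P (w @ [next_label P (Suc n mod 3) (last w)]) (Suc n div 3))"
  by auto
termination by (relation "measure (\<lambda>(P, w, n). n)") auto

declare trace.simps [simp del]

lemma trace_nonempty: "w \<noteq> [] \<Longrightarrow> trace P w n \<noteq> []"
  by (induction P w n rule: trace.induct) (subst trace.simps, simp)

lemma hd_trace: "w \<noteq> [] \<Longrightarrow> hd (trace P w n) = hd w"
  by (induction P w n rule: trace.induct) (subst trace.simps, simp)

text \<open>Stated with \<open>next_label\<close> instead of \<open>label_succ\<close>, because a
  digit may select an undefined operation and yield \<open>0\<close>.\<close>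

lemma trace_steps:
  assumes "w \<noteq> []" "\<forall>t. Suc t < length w \<longrightarrow> (\<exists>d<3. w ! Suc t = next_label P d (w ! t))"
  shows "\<forall>t. Suc t < length (trace P w n) \<longrightarrow>
    (\<exists>d<3. trace P w n ! Suc t = next_label P d (trace P w n ! t))"
  using assms
proof (induction P w n rule: trace.induct)
  case (1 P w n)
  show ?case
  proof (cases "n \<le> 1")
    case True
    then show ?thesis using 1(3) by (simp add: trace.simps[of P w n])
  next
    case False
    let ?v = "w @ [next_label P (Suc n mod 3) (last w)]"
    have "\<exists>d<3. ?v ! Suc t = next_label P d (?v ! t)" if "Suc t < length ?v" for t
    proof (cases "Suc t < length w")
      case True
      then show ?thesis using 1(3) by (simp add: nth_append)
    next
      case False
      then have "t = length w - 1" using that 1(2) by simp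
      then show ?thesis using 1(2)
        by (intro exI[of _ "Suc n mod 3"]) (simp add: nth_append last_conv_nth)
    qed
    then show ?thesis using 1(1)[OF False] False by (simp add: trace.simps[of P w n])
  qed
qed

text \<open>\<open>trace\<close> consumes the lowest digit first, so the number for the tail is
  found first and the digit for \<open>x\<close> is attached below it.\<close>

lemma trace_onto:
  assumes "w \<noteq> []" "\<forall>t. Suc t < length (w @ v) \<longrightarrow> label_succ P ((w @ v) ! t) ((w @ v) ! Suc t)"
  shows "\<exists>n\<ge>1. trace P w n = w @ v"
  using assms
proof (induction v arbitrary: w)
  case Nil
  show ?case by (intro exI[of _ 1]) (simp add: trace.simps)
next
  case (Cons x v)
  have "label_succ P (last w) x"
    using Cons.prems(1) Cons.prems(2)[rule_format, of "length w - 1"]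
    by (simp add: nth_append last_conv_nth split: if_splits)
  then obtain d where d: "d < 3" "x = next_label P d (last w)"
    using label_succ_imp_next_label by blast
  obtain q where q: "q \<ge> 1" "trace P (w @ [x]) q = (w @ [x]) @ v"
    using Cons.IH[of "w @ [x]"] Cons.prems by auto
  \<comment> \<open>Solves \<open>n + 1 = 3 q + d\<close>; as \<open>q \<ge> 1\<close>, this is at
    least 2, so \<open>trace\<close> does not stop here.\<close>
  let ?n = "3 * q + d - 1"
  have n: "Suc ?n = 3 * q + d" "\<not> ?n \<le> 1" using q(1) by auto
  have "trace P w ?n = trace P (w @ [x]) q"
    using d n by (subst trace.simps) simp
  then show ?case using q n by (intro exI[of _ ?n]) auto
qed

text \<open>Once an entry is \<open>0\<close>, all later ones are; hence a nonzero last entry makes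
  every entry nonzero and every step a \<open>label_succ\<close>.\<close>

lemma finite_path_trace:
  assumes "is_program \<sigma> P" "last (trace P [1] n) = stop_label P"
  shows "finite_path P (trace P [1] n)"
proof -
  let ?w = "trace P [1] n"
  have ne: "?w \<noteq> []" by (simp add: trace_nonempty)
  have steps: "\<exists>d<3. ?w ! Suc t = next_label P d (?w ! t)" if "Suc t < length ?w" for t
    using trace_steps[of "[1]" P n] that by simp
  \<comment> \<open>\<open>0\<close> is not an inner label, so all three partial maps are undefined
    there.\<close>
  have zero: "next_label P d 0 = 0" if "d < 3" for d
    using next_label_imp_label_succ[OF that, of P 0] label_succ_inner[of P 0]
    by (auto simp: inner_labels_def)
  \<comment> \<open>\<open>i\<close> counts backwards from the last entry, the stop label.\<close>
  have nonzero: "?w ! (length ?w - Suc i) \<noteq> 0" if "i < length ?w" for i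
    using that
  proof (induction i)
    case 0
    then show ?case using assms(2) ne by (simp add: last_conv_nth stop_label_def)
  next
    case (Suc i)
    moreover have "Suc (length ?w - Suc (Suc i)) = length ?w - Suc i" using Suc.prems by simp
    ultimately show ?case using steps[of "length ?w - Suc (Suc i)"] zero Suc.prems
      by (metis Suc_lessD diff_less ne length_greater_0_conv zero_less_Suc)
  qed
  have "label_succ P (?w ! t) (?w ! Suc t)" if t: "Suc t < length ?w" for t
  proof -
    have "?w ! Suc t \<noteq> 0" using nonzero[of "length ?w - Suc (Suc t)"] t by (simp add: Suc_diff_Suc)
    then show ?thesis using steps[OF t] next_label_imp_label_succ by metis
  qed
  then show ?thesis using ne assms(2) hd_trace[of "[1]" P n] finite_path_iff[OF assms(1)] by simp
qed

lemma trace_onto_Lab_fin: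
  assumes "is_program \<sigma> P" "ls \<in> Lab_fin P"
  shows "\<exists>n\<ge>1. trace P [1] n = ls"
proof -
  have fp: "ls \<noteq> []" "hd ls = 1" "\<forall>t. Suc t < length ls \<longrightarrow> label_succ P (ls ! t) (ls ! Suc t)"
    using assms finite_path_iff by (auto simp: Lab_fin_def)
  then have "ls = [1] @ tl ls" by (cases ls) auto
  then show ?thesis using trace_onto[of "[1]" "tl ls" P] fp(3) by simp
qed

section \<open>The machine\<close>

abbreviation Goto :: "nat \<Rightarrow> det_instr" where
  "Goto l \<equiv> IfIndexEq 1 1 l l"

text \<open>Labels 1--5 fill the input registers with \<open>1\<close>. From label 6 on, \<open>I_1\<close> holds the number \<open>n\<close> still
  to be decoded, \<open>I_4\<close> the length of the path and \<open>I_5 = 1\<close>; at labels 10--17 the invariant is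
  \<open>I_2 = 3 I_3 - 1\<close>, and \<open>I_3\<close> becomes the quotient. From label 29 on the last entry, held in \<open>Z_1\<close>, is
  compared with the stop label \<open>s\<close> in \<open>Z_2\<close>, whose content is meanwhile kept just behind the path.
  Label 41 restarts the decoding with \<open>n = k + 1\<close>.\<close>

definition enum_head :: "nat \<Rightarrow> nat \<Rightarrow> det_instr list" where
  "enum_head s k =
    [LoadConst 1 1,
     IfIndexEq 2 1 6 3,
     IndexIncr 2,
     Copy 2 5,
     Goto 2,
     IfIndexEq 1 5 29 7,
     IndexOne 2,
     IndexIncr 2,
     IndexOne 3,
     IfIndexEq 2 1 18 11,
     IndexIncr 2,
     IfIndexEq 2 1 20 13,
     IndexIncr 2,
     IfIndexEq 2 1 22 15,
     IndexIncr 2,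
     IndexIncr 3,
     Goto 10,
     Apply 1 0 [1],
     Goto 23,
     Apply 1 1 [1],
     Goto 23,
     Apply 1 2 [1],
     IndexIncr 4,
     Copy 4 5,
     IndexOne 1,
     IfIndexEq 1 3 6 27,
     IndexIncr 1,
     Goto 26,
     IfIndexEq 1 4 32 30,
     IndexIncr 1,
     Goto 29,
     IndexOne 2,
     IndexIncr 2,
     IndexIncr 4,
     Copy 4 2,
     LoadConst 2 s,
     IfRel 0 [1, 2] 38 41,
     Copy 2 4,
     LoadConst 1 1,
     Goto (45 + k),
     LoadConst 1 1,
     IndexOne 4,
     IndexOne 1]"

text \<open>An index register can only be set to \<open>1\<close> and incremented, so the fixed
  number \<open>k + 1\<close> takes \<open>k\<close> increments.\<close>

definition enum_machine :: "instr list \<Rightarrow> nat \<Rightarrow> machine" where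
  "enum_machine P k =
     \<lparr>code = enum_head (stop_label P) k @ replicate k (IndexIncr 1) @ [Goto 6], num_index = 5\<rparr>"

lemma length_enum_head: "length (enum_head s k) = 43"
  by (simp add: enum_head_def)

lemma stop_label_enum_machine: "stop_label (code (enum_machine P k)) = 45 + k"
  by (simp add: enum_machine_def stop_label_def length_enum_head)

lemma enum_machine_in_machines: "enum_machine P k \<in> machines (label_structure P)"
proof -
  \<comment> \<open>Ensures that the constant \<open>1\<close> loaded by the head occurs in
    \<open>const_list\<close>.\<close>
  have "stop_label P \<ge> 1" by (simp add: stop_label_def)
  moreover have "labels (code (enum_machine P k)) = {1..45 + k}"
    by (simp only: labels_def stop_label_enum_machine)
  ultimately show ?thesis
    by (auto simp: machines_def enum_machine_def enum_head_def signature_of_def label_structure_def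
        simp del: upt_Suc)
qed

section \<open>Execution of single instructions\<close>

context
  fixes P :: "instr list" and k :: nat
begin

abbreviation (input) A where "A \<equiv> label_structure P"
abbreviation (input) M where "M \<equiv> enum_machine P k"

lemma step_head:
  assumes "l \<ge> 1" "l \<le> 43"
  shows "step A M \<lparr>lab = l, ireg = I, zreg = Z\<rparr> =
    exec A (enum_head (stop_label P) k ! (l - 1)) \<lparr>lab = l, ireg = I, zreg = Z\<rparr>"
  using assms stop_label_enum_machine[of P k]
  by (auto simp: step_def inner_labels_def instr_at_def enum_machine_def nth_append length_enum_head)

lemma step_tail:
  "i < k \<Longrightarrow> step A M \<lparr>lab = 44 + i, ireg = I, zreg = Z\<rparr> =
     \<lparr>lab = 44 + Suc i, ireg = I(1 := I 1 + 1), zreg = Z\<rparr>"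
  "step A M \<lparr>lab = 44 + k, ireg = I, zreg = Z\<rparr> = \<lparr>lab = 6, ireg = I, zreg = Z\<rparr>"
  using stop_label_enum_machine[of P k]
  by (auto simp: step_def inner_labels_def instr_at_def enum_machine_def nth_append length_enum_head)

lemma const_label_structure:
  "const_list A ! stop_label P = stop_label P"
  "const_list A ! Suc 0 = Suc 0"
  by (simp_all add: label_structure_def stop_label_def del: upt_Suc)

lemma rel_label_structure: "snd (rel_list A ! 0) xs \<longleftrightarrow> xs ! 0 = xs ! 1"
  by (simp add: label_structure_def)

text \<open>Backward rule for one instruction; repeated with \<open>simp\<close> it executes a
  stretch of code symbolically.\<close>

lemma reaches_head:
  assumes "l \<noteq> p" "l \<ge> 1" "l \<le> 43"
    "reaches A M p Q (exec A (enum_head (stop_label P) k ! (l - 1)) \<lparr>lab = l, ireg = I, zreg = Z\<rparr>)"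
  shows "reaches A M p Q \<lparr>lab = l, ireg = I, zreg = Z\<rparr>"
  using assms by - (rule later, simp_all add: step_head)

lemmas exec_head = enum_head_def const_label_structure rel_label_structure next_label_def[symmetric]

section \<open>Counting loops and decoding rounds\<close>

text \<open>\<open>r\<close> is the distance from \<open>I_2\<close> up to \<open>I_1\<close>. A
  round uses up three units and adds one to \<open>I_3\<close>; the exit taken at
  \<open>r < 3\<close> selects the operation. \<open>p > 43\<close> keeps \<open>p\<close> off the
  labels passed.\<close>

lemma division_loop:
  assumes p: "p > 43" and "I 2 + r = I 1"
    and "reaches A M p Q \<lparr>lab = 23, ireg = I(2 := I 1, 3 := I 3 + r div 3),
      zreg = Z(1 := next_label P (r mod 3) (Z 1))\<rparr>"
  shows "reaches A M p Q \<lparr>lab = 10, ireg = I, zreg = Z\<rparr>"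
  using assms(2,3)
proof (induction r arbitrary: I rule: less_induct)
  case (less r)
  consider "r = 0" | "r = 1" | "r = 2" | "r = (r - 3) + 3" by linarith
  then show ?case
  proof cases
    case 1
    then have eq: "I(2 := I 1, 3 := I 3 + r div 3) = I"
      using less.prems(1) by auto
    have "reaches A M p Q \<lparr>lab = 23, ireg = I,
        zreg = Z(1 := next_label P 0 (Z 1))\<rparr>"
      using less.prems(2) unfolding eq by (simp add: 1 del: fun_upd_apply)
    then show ?thesis using p less.prems(1)[symmetric] 1
      by - (rule reaches_head, simp, simp, simp, simp add: exec_head)+
  next
    case 2
    then have eq: "I(2 := I 1, 3 := I 3 + r div 3) = I(2 := Suc (I 2))"
      using less.prems(1) by auto
    have "reaches A M p Q \<lparr>lab = 23, ireg = I(2 := Suc (I 2)),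
        zreg = Z(1 := next_label P 1 (Z 1))\<rparr>"
      using less.prems(2) unfolding eq by (simp add: 2 del: fun_upd_apply)
    then show ?thesis using p less.prems(1)[symmetric] 2
      by - (rule reaches_head, simp, simp, simp, simp add: exec_head)+
  next
    case 3
    then have eq: "I(2 := I 1, 3 := I 3 + r div 3) = I(2 := Suc (Suc (I 2)))"
      using less.prems(1) by auto
    have "reaches A M p Q \<lparr>lab = 23, ireg = I(2 := Suc (Suc (I 2))),
        zreg = Z(1 := next_label P 2 (Z 1))\<rparr>"
      using less.prems(2) unfolding eq by (simp add: 3 del: fun_upd_apply)
    then show ?thesis using p less.prems(1)[symmetric] 3
      by - (rule reaches_head, simp, simp, simp, simp add: exec_head)+
  next
    case 4
    let ?I = "I(2 := Suc (Suc (Suc (I 2))), 3 := Suc (I 3))"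
    obtain r' where r': "r = r' + 3" using 4 ..
    have r: "r div 3 = Suc (r' div 3)" "r mod 3 = r' mod 3" unfolding r' by simp_all
    have eq: "I(2 := I 1, 3 := I 3 + r div 3) = ?I(2 := ?I 1, 3 := ?I 3 + r' div 3)"
      unfolding r by auto
    have "reaches A M p Q \<lparr>lab = 10, ireg = ?I, zreg = Z\<rparr>"
    proof (rule less.IH[of r'])
      show "r' < r" "?I 2 + r' = ?I 1" using r' less.prems(1) by auto
      show "reaches A M p Q \<lparr>lab = 23, ireg = ?I(2 := ?I 1, 3 := ?I 3 + r' div 3),
          zreg = Z(1 := next_label P (r' mod 3) (Z 1))\<rparr>"
        using less.prems(2) unfolding eq r(2) .
    qed
    then show ?thesis using p less.prems(1) r'
      by - (rule reaches_head, simp, simp, simp, simp add: exec_head)+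
  qed
qed

text \<open>There is no assignment between index registers, so the quotient is transferred by
  counting \<open>I_1\<close> up to \<open>I_3\<close>.\<close>

lemma copy_loop:
  assumes p: "p > 43" and "I 1 + r = I 3"
    and "reaches A M p Q \<lparr>lab = 6, ireg = I(1 := I 3), zreg = Z\<rparr>"
  shows "reaches A M p Q \<lparr>lab = 26, ireg = I, zreg = Z\<rparr>"
  using assms(2,3)
proof (induction r arbitrary: I)
  case 0
  then have eq: "I(1 := I 3) = I" by auto
  have "reaches A M p Q \<lparr>lab = 6, ireg = I, zreg = Z\<rparr>"
    using 0(2) unfolding eq .
  then show ?case using p 0(1)
    by - (rule reaches_head, simp, simp, simp, simp add: exec_head)
next
  case (Suc r)
  let ?I = "I(1 := Suc (I 1))"
  have eq: "?I(1 := ?I 3) = I(1 := I 3)" by simp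
  have "reaches A M p Q \<lparr>lab = 26, ireg = ?I, zreg = Z\<rparr>"
  proof (rule Suc.IH)
    show "?I 1 + r = ?I 3" using Suc.prems(1) by simp
    show "reaches A M p Q \<lparr>lab = 6, ireg = ?I(1 := ?I 3), zreg = Z\<rparr>"
      unfolding eq by (rule Suc.prems(2))
  qed
  then show ?case using p Suc.prems(1)
    by - (rule reaches_head, simp, simp, simp, simp add: exec_head)+
qed

lemma length_loop:
  assumes p: "p > 43" and "I 1 + r = I 4"
    and "reaches A M p Q \<lparr>lab = 32, ireg = I(1 := I 4), zreg = Z\<rparr>"
  shows "reaches A M p Q \<lparr>lab = 29, ireg = I, zreg = Z\<rparr>"
  using assms(2,3)
proof (induction r arbitrary: I)
  case 0
  then have eq: "I(1 := I 4) = I" by auto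
  have "reaches A M p Q \<lparr>lab = 32, ireg = I, zreg = Z\<rparr>"
    using 0(2) unfolding eq .
  then show ?case using p 0(1)
    by - (rule reaches_head, simp, simp, simp, simp add: exec_head)
next
  case (Suc r)
  let ?I = "I(1 := Suc (I 1))"
  have eq: "?I(1 := ?I 4) = I(1 := I 4)" by simp
  have "reaches A M p Q \<lparr>lab = 29, ireg = ?I, zreg = Z\<rparr>"
  proof (rule Suc.IH)
    show "?I 1 + r = ?I 4" using Suc.prems(1) by simp
    show "reaches A M p Q \<lparr>lab = 32, ireg = ?I(1 := ?I 4), zreg = Z\<rparr>"
      unfolding eq by (rule Suc.prems(2))
  qed
  then show ?case using p Suc.prems(1)
    by - (rule reaches_head, simp, simp, simp, simp add: exec_head)+
qed

text \<open>The first entry of the path is always \<open>1\<close>, so \<open>Z_1\<close> can hold the current label instead.\<close>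

definition stores :: "(nat \<Rightarrow> nat) \<Rightarrow> (nat \<Rightarrow> nat) \<Rightarrow> nat list \<Rightarrow> bool" where
  "stores I Z w \<longleftrightarrow> w \<noteq> [] \<and> I 4 = length w \<and> I 5 = 1 \<and> Z 1 = last w \<and>
     (\<forall>t. 1 \<le> t \<and> t < length w \<longrightarrow> Z (Suc t) = w ! t)"

text \<open>The hypothesis at label 29 covers all registers satisfying \<open>stores\<close>, since
  \<open>I_2\<close> and \<open>I_3\<close> carry leftovers of the rounds. The induction is strong,
  as a round replaces \<open>n\<close> by \<open>Suc n div 3\<close>.\<close>

lemma trace_loop:
  assumes p: "p > 43" and "I 1 \<ge> 1" "stores I Z w"
    and "\<And>I Z. I 1 = 1 \<Longrightarrow> stores I Z (trace P w n) \<Longrightarrow> reaches A M p Q \<lparr>lab = 29, ireg = I, zreg = Z\<rparr>"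
    and "I 1 = n"
  shows "reaches A M p Q \<lparr>lab = 6, ireg = I, zreg = Z\<rparr>"
  using assms(2-5)
proof (induction n arbitrary: I Z w rule: less_induct)
  case (less n)
  show ?case
  proof (cases "n = 1")
    case True
    then have "reaches A M p Q \<lparr>lab = 29, ireg = I, zreg = Z\<rparr>"
      using less.prems by (simp add: trace.simps)
    moreover have "I 1 = I 5" using True less.prems(2,4) by (simp add: stores_def)
    ultimately show ?thesis using p
      by - (rule reaches_head, simp, simp, simp, simp add: exec_head)
  next
    case False
    then have n: "n \<ge> 2" "I 1 = n" "I 5 = 1" using less.prems by (auto simp: stores_def)
    define x where "x = next_label P (Suc n mod 3) (last w)"
    let ?I = "I(2 := n, 3 := Suc n div 3, 4 := Suc (I 4), 1 := Suc n div 3)"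
    \<comment> \<open>\<open>x\<close> is written twice, as current label and as new path entry;
      \<open>I_4 \<ge> 1\<close> keeps the two cells apart.\<close>
    let ?Z = "Z(1 := x, Suc (I 4) := x)"
    have st: "stores ?I ?Z (w @ [x])"
      using less.prems(2) by (auto simp: stores_def nth_append)
    have tr: "trace P w n = trace P (w @ [x]) (Suc n div 3)"
      using n by (subst trace.simps) (simp add: x_def)
    have 6: "reaches A M p Q \<lparr>lab = 6, ireg = ?I, zreg = ?Z\<rparr>"
    proof (rule less.IH)
      show "Suc n div 3 < n" "1 \<le> ?I 1" "?I 1 = Suc n div 3" using n(1) by auto
      show "reaches A M p Q \<lparr>lab = 29, ireg = I', zreg = Z'\<rparr>"
        if "I' 1 = 1" "stores I' Z' (trace P (w @ [x]) (Suc n div 3))" for I' Z'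
        using that less.prems(3) tr by simp
    qed (rule st)
    let ?J = "I(2 := n, 3 := Suc n div 3, 4 := Suc (I 4), 1 := 1)"
    have "reaches A M p Q \<lparr>lab = 26, ireg = ?J, zreg = ?Z\<rparr>"
    proof (rule copy_loop[OF p])
      show "?J 1 + (Suc n div 3 - 1) = ?J 3" using n(1) by simp
      have eq: "?J(1 := ?J 3) = ?I" by simp
      show "reaches A M p Q \<lparr>lab = 6, ireg = ?J(1 := ?J 3), zreg = ?Z\<rparr>"
        unfolding eq by (rule 6)
    qed
    then have 23: "reaches A M p Q \<lparr>lab = 23, ireg = I(2 := n, 3 := Suc n div 3), zreg = Z(1 := x)\<rparr>"
      using p n(3)
      by - (rule reaches_head, simp, simp, simp, simp add: exec_head)+
    \<comment> \<open>Labels 7 to 9 start the division with these values; the remaining distance is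
      \<open>n - 2\<close>.\<close>
    let ?K = "I(2 := 2, 3 := 1)"
    have "reaches A M p Q \<lparr>lab = 10, ireg = ?K, zreg = Z\<rparr>"
    proof (rule division_loop[OF p])
      show "?K 2 + (n - 2) = ?K 1" using n by simp
      \<comment> \<open>The added 3 corresponds to the initial value \<open>1\<close> of
        \<open>I_3\<close>.\<close>
      have "Suc n = (n - 2) + 3" using n(1) by simp
      then have arith: "Suc n mod 3 = (n - 2) mod 3" "Suc n div 3 = 1 + (n - 2) div 3"
        by (simp_all only: mod_add_self2)
      have "Z 1 = last w" using less.prems(2) by (simp add: stores_def)
      then have "Z(1 := next_label P ((n - 2) mod 3) (Z 1)) = Z(1 := x)"
        by (simp only: x_def arith(1))
      moreover have "?K(2 := ?K 1, 3 := ?K 3 + (n - 2) div 3) = I(2 := n, 3 := Suc n div 3)"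
        unfolding arith(2) using n(2) by auto
      ultimately show "reaches A M p Q \<lparr>lab = 23, ireg = ?K(2 := ?K 1, 3 := ?K 3 + (n - 2) div 3),
          zreg = Z(1 := next_label P ((n - 2) mod 3) (Z 1))\<rparr>"
        using 23 by (simp only:)
    qed
    then show ?thesis using p n
      by - (rule reaches_head, simp, simp, simp, simp add: exec_head numeral_2_eq_2)+
  qed
qed


section \<open>Restart and test against the stop label\<close>

lemma tail_loop:
  assumes p: "p = 45 + k" and "i + j = k"
    and "reaches A M p Q \<lparr>lab = 6, ireg = I(1 := I 1 + j), zreg = Z\<rparr>"
  shows "reaches A M p Q \<lparr>lab = 44 + i, ireg = I, zreg = Z\<rparr>"
  using assms(2,3)
proof (induction j arbitrary: i I)
  case 0
  have eq: "I(1 := I 1 + 0) = I" by auto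
  have "reaches A M p Q \<lparr>lab = 6, ireg = I, zreg = Z\<rparr>"
    using 0(2) unfolding eq .
  then show ?case using p 0(1)
    by - (rule later, simp, simp only: add_0_right step_tail(2))
next
  case (Suc j)
  let ?I = "I(1 := I 1 + 1)"
  have eq: "?I(1 := ?I 1 + j) = I(1 := I 1 + Suc j)" by simp
  have "reaches A M p Q \<lparr>lab = 44 + Suc i, ireg = ?I, zreg = Z\<rparr>"
  proof (rule Suc.IH)
    show "Suc i + j = k" using Suc.prems(1) by simp
    show "reaches A M p Q \<lparr>lab = 6, ireg = ?I(1 := ?I 1 + j), zreg = Z\<rparr>"
      unfolding eq by (rule Suc.prems(2))
  qed
  moreover have "i < k" using Suc.prems(1) by simp
  ultimately show ?case using p
    by - (rule later, simp, simp only: step_tail(1))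
qed

text \<open>Common prefix of acceptance and rejection. A constant can be compared only through a
  register, so \<open>Z_2\<close> is saved behind the path before the stop label is loaded into
  it.\<close>

lemma test_trace:
  assumes p: "p > 43" and I: "I 1 = 1" and w: "stores I Z w"
    and target: "\<And>I'. I' 1 = length w \<Longrightarrow> I' 2 = 2 \<Longrightarrow> I' 4 = Suc (length w) \<Longrightarrow> I' 5 = 1 \<Longrightarrow>
      reaches A M p Q \<lparr>lab = if last w = stop_label P then 38 else 41, ireg = I',
        zreg = Z(Suc (length w) := Z 2, 2 := stop_label P)\<rparr>"
  shows "reaches A M p Q \<lparr>lab = 29, ireg = I, zreg = Z\<rparr>"
proof (rule length_loop[OF p])
  have m: "length w > 0" "I 4 = length w" "Z 1 = last w" "I 5 = 1" using w by (auto simp: stores_def)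
  show "I 1 + (I 4 - 1) = I 4" using I m by simp
  have "reaches A M p Q \<lparr>lab = if last w = stop_label P then 38 else 41,
      ireg = I(1 := I 4, 2 := 2, 4 := Suc (length w)),
      zreg = Z(Suc (length w) := Z 2, 2 := stop_label P)\<rparr>"
    using m by (intro target) auto
  then show "reaches A M p Q \<lparr>lab = 32, ireg = I(1 := I 4), zreg = Z\<rparr>"
    using p m
    by - (rule reaches_head, simp, simp, simp, simp add: exec_head numeral_2_eq_2 split del: if_split)+
qed

text \<open>Only \<open>Z_1\<close> and \<open>Z_2\<close> differ from the path: the former is reset
  to \<open>hd w = 1\<close>, the latter gets its saved value. For \<open>length w = 1\<close> that
  value is lost, but then \<open>Z_2\<close> is not output.\<close>

lemma accept_trace:
  assumes p: "p = 45 + k" and "I 1 = 1" "stores I Z w" "hd w = 1" "last w = stop_label P"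
  shows "reaches A M p (\<lambda>c. lab c = p \<and> out_tuple c = w) \<lparr>lab = 29, ireg = I, zreg = Z\<rparr>"
proof (rule test_trace[OF _ assms(2,3)])
  show "p > 43" using p by simp
  fix I' :: "nat \<Rightarrow> nat"
  assume I': "I' 1 = length w" "I' 2 = 2" "I' 4 = Suc (length w)" "I' 5 = 1"
  let ?Z = "Z(Suc (length w) := Z 2, 2 := stop_label P)"
  let ?Z' = "?Z(2 := ?Z (Suc (length w)), 1 := 1)"
  let ?Q = "\<lambda>c. lab c = p \<and> out_tuple c = w"
  have w: "w \<noteq> []" "\<And>t. 1 \<le> t \<Longrightarrow> t < length w \<Longrightarrow> Z (Suc t) = w ! t"
    using assms(3) by (auto simp: stores_def)
  have "out_tuple \<lparr>lab = p, ireg = I', zreg = ?Z'\<rparr> = w"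
  proof (rule nth_equalityI)
    show "length (out_tuple \<lparr>lab = p, ireg = I', zreg = ?Z'\<rparr>) = length w"
      using I' by (simp add: out_tuple_eq)
    fix t assume "t < length (out_tuple \<lparr>lab = p, ireg = I', zreg = ?Z'\<rparr>)"
    then have t: "t < length w" using I' by (simp add: out_tuple_eq)
    then have nth: "out_tuple \<lparr>lab = p, ireg = I', zreg = ?Z'\<rparr> ! t = ?Z' (Suc t)"
      using I' by (simp add: out_tuple_eq del: upt_Suc fun_upd_apply)
    consider "t = 0" | "t = 1" | "t \<ge> 2" by linarith
    then have "?Z' (Suc t) = w ! t"
    proof cases
      case 1
      then show ?thesis using assms(4) w(1) by (simp add: hd_conv_nth)
    next
      case 2
      then show ?thesis using w(2)[of 1] t by (simp add: numeral_2_eq_2)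
    next
      case 3
      then show ?thesis using w(2)[of t] t by simp
    qed
    with nth show "out_tuple \<lparr>lab = p, ireg = I', zreg = ?Z'\<rparr> ! t = w ! t" by simp
  qed
  then have stop: "reaches A M p ?Q \<lparr>lab = p, ireg = I', zreg = ?Z'\<rparr>"
    by (intro now) (simp del: fun_upd_apply)
  then have "reaches A M p ?Q \<lparr>lab = 40, ireg = I', zreg = ?Z'\<rparr>"
    using p I'
    by - (rule reaches_head, simp, simp, simp, simp add: exec_head del: fun_upd_apply)
  then have "reaches A M p ?Q \<lparr>lab = 39, ireg = I', zreg = ?Z(2 := ?Z (Suc (length w)))\<rparr>"
    using p I'
    by - (rule reaches_head, simp, simp, simp, simp add: exec_head del: fun_upd_apply)
  then have "reaches A M p ?Q \<lparr>lab = 38, ireg = I', zreg = ?Z\<rparr>"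
    using p I'
    by - (rule reaches_head, simp, simp, simp, simp add: exec_head del: fun_upd_apply)
  then show "reaches A M p ?Q \<lparr>lab = if last w = stop_label P then 38 else 41, ireg = I', zreg = ?Z\<rparr>"
    using assms(5) by (simp del: fun_upd_apply)
qed

text \<open>\<open>stores I Z [1]\<close> constrains only \<open>I_4\<close>, \<open>I_5\<close> and
  \<open>Z_1\<close>, so a restart need not erase old entries.\<close>

lemma reject_trace:
  assumes p: "p = 45 + k" and "I 1 = 1" "stores I Z w" "last w \<noteq> stop_label P"
    and "\<And>I Z. I 1 = Suc k \<Longrightarrow> stores I Z [1] \<Longrightarrow> reaches A M p Q \<lparr>lab = 6, ireg = I, zreg = Z\<rparr>"
  shows "reaches A M p Q \<lparr>lab = 29, ireg = I, zreg = Z\<rparr>"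
proof (rule test_trace[OF _ assms(2,3)])
  show "p > 43" using p by simp
  fix I' :: "nat \<Rightarrow> nat"
  assume I': "I' 1 = length w" "I' 2 = 2" "I' 4 = Suc (length w)" "I' 5 = 1"
  let ?Z = "Z(Suc (length w) := Z 2, 2 := stop_label P)"
  have "reaches A M p Q \<lparr>lab = 6, ireg = I'(4 := 1, 1 := Suc k), zreg = ?Z(1 := 1)\<rparr>"
    using I' by (intro assms(5)) (simp_all add: stores_def)
  then have "reaches A M p Q \<lparr>lab = 44 + 0, ireg = I'(4 := 1, 1 := 1), zreg = ?Z(1 := 1)\<rparr>"
    by (intro tail_loop[OF p, of 0 k]) simp_all
  then have "reaches A M p Q \<lparr>lab = 43, ireg = I'(4 := 1), zreg = ?Z(1 := 1)\<rparr>"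
    using p by - (rule reaches_head, simp, simp, simp, simp add: exec_head del: fun_upd_apply)
  then have "reaches A M p Q \<lparr>lab = 42, ireg = I', zreg = ?Z(1 := 1)\<rparr>"
    using p by - (rule reaches_head, simp, simp, simp, simp add: exec_head del: fun_upd_apply)
  then have "reaches A M p Q \<lparr>lab = 41, ireg = I', zreg = ?Z\<rparr>"
    using p by - (rule reaches_head, simp, simp, simp, simp add: exec_head del: fun_upd_apply)
  then show "reaches A M p Q \<lparr>lab = if last w = stop_label P then 38 else 41, ireg = I', zreg = ?Z\<rparr>"
    using assms(4) by (simp del: fun_upd_apply)
qed

section \<open>The first phase\<close>

text \<open>Each round copies \<open>Z_1\<close>, addressed by \<open>I_5 = 1\<close>, into the next
  register.\<close>

lemma fill_loop:
  assumes p: "p > 5" and "I 2 + r = I 1" and I: "I 5 = 1"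
    and Z: "\<And>t. 1 \<le> t \<Longrightarrow> t \<le> I 2 \<Longrightarrow> Z t = 1" "I 2 \<ge> 1"
    and "\<And>I' Z'. I' = I(2 := I 1) \<Longrightarrow> (\<And>t. 1 \<le> t \<Longrightarrow> t \<le> I 1 \<Longrightarrow> Z' t = 1) \<Longrightarrow>
      reaches A M p Q \<lparr>lab = 6, ireg = I', zreg = Z'\<rparr>"
  shows "reaches A M p Q \<lparr>lab = 2, ireg = I, zreg = Z\<rparr>"
  using assms(2-6)
proof (induction r arbitrary: I Z)
  case 0
  have "reaches A M p Q \<lparr>lab = 6, ireg = I, zreg = Z\<rparr>"
    using 0(1,3) by (intro 0(5)) auto
  then show ?case using p 0(1)
    by - (rule reaches_head, simp, simp, simp, simp add: exec_head)
next
  case (Suc r)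
  let ?I = "I(2 := Suc (I 2))" and ?Z = "Z(Suc (I 2) := 1)"
  have "reaches A M p Q \<lparr>lab = 2, ireg = ?I, zreg = ?Z\<rparr>"
  proof (rule Suc.IH)
    show "?I 2 + r = ?I 1" "?I 5 = 1" "?I 2 \<ge> 1" using Suc.prems(1,2) by simp_all
    show "?Z t = 1" if "1 \<le> t" "t \<le> ?I 2" for t
      using that Suc.prems(3)[of t] by (cases "t = Suc (I 2)") auto
    show "reaches A M p Q \<lparr>lab = 6, ireg = I', zreg = Z'\<rparr>"
      if "I' = ?I(2 := ?I 1)" "\<And>t. 1 \<le> t \<Longrightarrow> t \<le> ?I 1 \<Longrightarrow> Z' t = 1" for I' Z'
      using that by (intro Suc.prems(5)) simp_all
  qed
  moreover have "Z 1 = 1" using Suc.prems(3)[of 1] Suc.prems(4) by simp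
  ultimately show ?case using p Suc.prems(1,2)
    by - (rule reaches_head, simp, simp, simp, simp add: exec_head del: fun_upd_apply,
      (rule reaches_head, simp, simp, simp, simp add: exec_head)+)
qed

text \<open>Holds for every \<open>p > 5\<close>, as it serves both \<open>p = 6\<close>, the end of
  the phase, and the stop label. The initial values of \<open>I_4\<close> and \<open>I_5\<close>
  already fit the path \<open>[1]\<close>.\<close>

lemma fill_phase:
  assumes "xs \<noteq> []" "p > 5"
    and "\<And>I Z. I 1 = length xs \<Longrightarrow> I 4 = 1 \<Longrightarrow> I 5 = 1 \<Longrightarrow>
      (\<And>t. 1 \<le> t \<Longrightarrow> t \<le> length xs \<Longrightarrow> Z t = 1) \<Longrightarrow> reaches A M p Q \<lparr>lab = 6, ireg = I, zreg = Z\<rparr>"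
  shows "reaches A M p Q (init_config xs)"
proof -
  let ?I = "\<lambda>j::nat. if j = 1 then length xs else 1"
  let ?Z = "\<lambda>j. if j \<le> length xs then xs ! (j - 1) else last xs"
  have "reaches A M p Q \<lparr>lab = 2, ireg = ?I, zreg = ?Z(1 := 1)\<rparr>"
  proof (rule fill_loop[OF assms(2)])
    show "?I 2 + (length xs - 1) = ?I 1" using assms(1) by (cases xs) simp_all
    show "reaches A M p Q \<lparr>lab = 6, ireg = I', zreg = Z'\<rparr>"
      if "I' = ?I(2 := ?I 1)" "\<And>t. 1 \<le> t \<Longrightarrow> t \<le> ?I 1 \<Longrightarrow> Z' t = 1" for I' Z'
      using that by (intro assms(3)) simp_all
  qed auto
  then have "reaches A M p Q \<lparr>lab = 1, ireg = ?I, zreg = ?Z\<rparr>"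
    using assms(2)
    by - (rule reaches_head, simp, simp, simp,
      simp add: exec_head numeral_2_eq_2 del: fun_upd_apply)
  then show ?thesis by (simp add: init_config_def)
qed

section \<open>Results of the machine\<close>

text \<open>Label 6 may recur during decoding, but \<open>result_at\<close> looks at its first
  visit, which ends the first phase.\<close>

lemma result_at_fill_phase:
  assumes "xs \<noteq> []"
  shows "result_at A M 6 xs = Some (replicate (length xs) 1)"
proof (rule reaches_result_at, rule fill_phase[OF assms])
  fix I :: "nat \<Rightarrow> nat" and Z :: "nat \<Rightarrow> nat"
  assume "I 1 = length xs" "\<And>t. 1 \<le> t \<Longrightarrow> t \<le> length xs \<Longrightarrow> Z t = 1"
  then have "out_tuple \<lparr>lab = 6, ireg = I, zreg = Z\<rparr> = replicate (length xs) 1"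
    by (intro nth_equalityI) (simp_all add: out_tuple_eq del: upt_Suc)
  then show "reaches A M 6 (\<lambda>c. lab c = 6 \<and> out_tuple c = replicate (length xs) 1)
      \<lparr>lab = 6, ireg = I, zreg = Z\<rparr>"
    by (intro now) simp
qed simp

text \<open>By \<open>default\<close> a second decoding succeeds, so the machine restarts at most
  once.\<close>

lemma Res_enum_machine:
  assumes "xs \<noteq> []" and default: "last (trace P [1] (Suc k)) = stop_label P"
  shows "Res A M xs = Some (if last (trace P [1] (length xs)) = stop_label P
    then trace P [1] (length xs) else trace P [1] (Suc k))"
  unfolding Res_def
proof (rule reaches_result_at)
  let ?w = "trace P [1] (length xs)" and ?d = "trace P [1] (Suc k)" and ?p = "45 + k"
  let ?w' = "if last ?w = stop_label P then ?w else ?d"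
  let ?Q = "\<lambda>c. lab c = ?p \<and> out_tuple c = ?w'"
  have p: "?p > 43" "?p > 5" by simp_all
  have accept: "reaches A M ?p ?Q \<lparr>lab = 29, ireg = I, zreg = Z\<rparr>"
    if "I 1 = 1" "stores I Z ?w'" for I Z
    using that default by (intro accept_trace) (auto simp: hd_trace)
  have restart: "reaches A M ?p ?Q \<lparr>lab = 6, ireg = I, zreg = Z\<rparr>"
    if "last ?w \<noteq> stop_label P" "I 1 = Suc k" "stores I Z [1]" for I Z
    using p(1) that accept by (intro trace_loop[where w = "[1]" and n = "Suc k"]) auto
  have test: "reaches A M ?p ?Q \<lparr>lab = 29, ireg = I, zreg = Z\<rparr>"
    if "I 1 = 1" "stores I Z ?w" for I Z
  proof (cases "last ?w = stop_label P")
    case True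
    then show ?thesis using accept that by simp
  next
    case False
    then show ?thesis using restart by (intro reject_trace[OF refl that]) auto
  qed
  have "reaches A M ?p ?Q (init_config xs)"
  proof (rule fill_phase[OF assms(1) p(2)])
    fix I :: "nat \<Rightarrow> nat" and Z :: "nat \<Rightarrow> nat"
    assume "I 1 = length xs" "I 4 = 1" "I 5 = 1" "\<And>t. 1 \<le> t \<Longrightarrow> t \<le> length xs \<Longrightarrow> Z t = 1"
    moreover have "length xs \<ge> 1" using assms(1) by (cases xs) simp_all
    ultimately show "reaches A M ?p ?Q \<lparr>lab = 6, ireg = I, zreg = Z\<rparr>"
      using test by (intro trace_loop[OF p(1), where w = "[1]" and n = "length xs"])
        (auto simp: stores_def)
  qed
  then show "reaches A M (stop_label (code M)) (\<lambda>c. lab c = stop_label (code M) \<and> out_tuple c = ?w')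
      (init_config xs)"
    unfolding stop_label_enum_machine .
qed

end

theorem proposition4p16:
  fixes \<sigma> :: signature and P :: "instr list"
  assumes "is_program \<sigma> P"
    and "Lab_fin P \<noteq> {}"
  shows "BSS_enumerable (label_structure P) 1 (Lab_fin P)"
proof -
  obtain d n where d: "d \<in> Lab_fin P" "n \<ge> 1" "trace P [1] n = d"
    using assms trace_onto_Lab_fin by blast
  \<comment> \<open>Counting up from \<open>1\<close>, these increments rebuild the number
    \<open>n\<close> that encodes the default path \<open>d\<close>.\<close>
  let ?k = "n - 1"
  let ?A = "label_structure P" and ?M = "enum_machine P ?k"
  define f where "f us = (if last (trace P [1] (length us)) = stop_label P
    then trace P [1] (length us) else d)" for us :: "nat list"
  have last_path: "last ls = stop_label P" if "ls \<in> Lab_fin P" for ls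
    using that by (simp add: Lab_fin_def finite_path_def)
  have Res: "Res ?A ?M xs = Some (f xs)" if "xs \<noteq> []" for xs
    using Res_enum_machine[OF that, of P ?k] d last_path[OF d(1)] by (simp add: f_def)
  have "f ` tuples {1} = Lab_fin P"
  proof (intro equalityI subsetI)
    fix ls assume "ls \<in> f ` tuples {1}"
    then show "ls \<in> Lab_fin P"
      using d(1) finite_path_trace[OF assms(1)] by (auto simp: f_def Lab_fin_def)
  next
    fix ls assume ls: "ls \<in> Lab_fin P"
    then obtain m where m: "m \<ge> 1" "trace P [1] m = ls"
      using trace_onto_Lab_fin[OF assms(1)] by blast
    then have "ls = f (replicate m 1)" using last_path[OF ls] by (simp add: f_def)
    moreover have "replicate m 1 \<in> tuples {1}" using m(1) by (simp add: tuples_def)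
    ultimately show "ls \<in> f ` tuples {1}" by blast
  qed
  \<comment> \<open>\<open>f\<close> sees only the length, so an input and the tuple of ones of
    equal length give the same result.\<close>
  moreover have "f (replicate (length xs) 1) = f xs" for xs by (simp add: f_def)
  \<comment> \<open>Label 6 is the witness for the end of the first phase.\<close>
  moreover have "6 \<in> labels (code ?M)"
    unfolding labels_def stop_label_enum_machine by simp
  moreover have "Lab_fin P \<subseteq> tuples (univ ?A)" "1 \<in> univ ?A"
    by (auto simp: Lab_fin_def finite_path_def tuples_def label_structure_def labels_def
        stop_label_def)
  ultimately show ?thesis
    unfolding BSS_enumerable_def
    using enum_machine_in_machines[of P ?k] Res result_at_fill_phase[of _ P ?k]
    by (intro conjI bexI[of _ ?M] exI[of _ f] bexI[of _ "6::nat"])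
      (simp_all add: tuples_def)
qed

end
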